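(* Let $n,m\ge 1$, $x_0\in\mathbb{R}^n$ and $r>0$. Let $F:D^n_r(x_0)\to\mathbb{R}^m$ be a continuous map such that $F(x)\neq 0$ for every $x\in S^{n-1}_r(x_0)$, and let $F_\mid:S^{n-1}_r(x_0)\to\mathbb{R}^m\setminus\{0\}$, $F_\mid(x)=F(x)$, be the restriction. If $\mathrm{secat}(F_\mid)=1$, then the equation $F(x)=0$ has a solution $x\in D^n_r(x_0)$.
   Context: $D^n_r(x_0)=\{x\in\mathbb{R}^n:\|x-x_0\|\le r\}$ and $S^{n-1}_r(x_0)=\{x\in\mathbb{R}^n:\|x-x_0\|=r\}$. The sectional category $\mathrm{secat}(f)$ of a continuous map $f:X\to Y$ is the least positive integer $k$ such that there are open subsets $U_1,\dots,U_k$ of $Y$ with $Y=U_1\cup\cdots\cup U_k$ and, for each $j$, a continuous map $s_j:U_j\to X$ such that $f\circ s_j$ is homotopic to the inclusion $U_j\hookrightarrow Y$. In particular $\mathrm{secat}(f)=1$ if and only if there is a continuous map $s:Y\to X$ with $f\circ s$ homotopic to the identity $1_Y$. Homotopies are free (no base points). *)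

theory Defs
  imports "HOL-Analysis.Analysis"
begin

text \<open>
  Maps are total functions regarded on the carrier of their domain topology, so a restriction of
  a map is expressed by changing the topologies, not the function: the values of \<open>f\<close> off
  \<open>topspace X\<close> are never used below, since the partial sections take values in \<open>topspace X\<close>.
  The constraint \<open>\<lambda>_. True\<close> in \<open>homotopic_with\<close> makes the homotopies free.
\<close>

definition secat_cover ::
    "'a topology \<Rightarrow> 'b topology \<Rightarrow> ('a \<Rightarrow> 'b) \<Rightarrow> nat \<Rightarrow> (nat \<Rightarrow> 'b set) \<Rightarrow> bool"
  where "secat_cover X Y f k U \<longleftrightarrow>
    (\<forall>j\<in>{1..k}. openin Y (U j)) \<and>
    topspace Y = (\<Union>j\<in>{1..k}. U j) \<and>
    (\<forall>j\<in>{1..k}. \<exists>s. continuous_map (subtopology Y (U j)) X s \<and>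
       homotopic_with (\<lambda>_. True) (subtopology Y (U j)) Y (f \<circ> s) id)"

text \<open>The infimum of the empty set is \<open>\<infinity>\<close>: the value when no finite cover exists.\<close>

definition secat :: "'a topology \<Rightarrow> 'b topology \<Rightarrow> ('a \<Rightarrow> 'b) \<Rightarrow> enat"
  where "secat X Y f = Inf {enat k | k. 1 \<le> k \<and> (\<exists>U. secat_cover X Y f k U)}"

end

theory Submission
  imports Defs
begin

text \<open>
  If \<open>F\<close> had no zero, then \<open>F \<circ> s\<close>, with \<open>s\<close> the homotopy section given by \<open>secat = 1\<close>, would
  factor through the contractible ball inside the punctured space. Being homotopic to the
  identity, it would make the punctured space, and hence its retract the unit sphere, contractible.
\<close>

text \<open>The infimum is attained, so the value 1 comes from an actual cover by one set, which
  must be all of \<open>Y\<close>.\<close>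

lemma secat_eq_1_imp_homotopy_section:
  assumes "secat X Y f = 1"
  obtains s where "continuous_map Y X s" "homotopic_with (\<lambda>_. True) Y Y (f \<circ> s) id"
proof -
  let ?K = "{enat k | k. 1 \<le> k \<and> (\<exists>U. secat_cover X Y f k U)}"
  \<comment> \<open>Otherwise the infimum would be infinite rather than 1.\<close>
  have "?K \<noteq> {}"
  proof
    assume "?K = {}"
    then have "secat X Y f = Inf {}"
      by (simp only: secat_def)
    with assms show False
      by (simp add: Inf_enat_def)
  qed
  then obtain x where "x \<in> ?K"
    unfolding ex_in_conv[symmetric] ..
  \<comment> \<open>\<open>enat\<close> is well-ordered, so a nonempty set contains its
    infimum.\<close>
  then have "Inf ?K \<in> ?K"
    by (rule wellorder_InfI)
  then have "1 \<in> ?K"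
    using assms by (simp only: secat_def)
  then obtain k U where "1 = enat k" "secat_cover X Y f k U"
    unfolding mem_Collect_eq by (elim exE conjE)
  then have "secat_cover X Y f 1 U"
    by (simp add: one_enat_def)
  then have "U 1 = topspace Y"
    and "\<exists>s. continuous_map (subtopology Y (U 1)) X s \<and>
      homotopic_with (\<lambda>_. True) (subtopology Y (U 1)) Y (f \<circ> s) id"
    unfolding secat_cover_def by simp_all
  then show thesis
    using that by (elim exE conjE) (simp only: subtopology_topspace)
qed

lemma not_contractible_punctured_space:
  "\<not> contractible (- {a :: 'a::euclidean_space})"
proof
  assume "contractible (- {a})"
  have "a \<in> rel_interior (cball a 1)"
    by (simp add: rel_interior_nonempty_interior)
  \<comment> \<open>The unit sphere is the relative frontier of the ball, and the ball's affine hull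
    is the whole space because its interior is nonempty.\<close>
  then have "sphere a 1 retract_of affine hull cball a 1 - {a}"
    using rel_frontier_retract_of_punctured_affine_hull[of "cball a 1" a] by simp
  then have "sphere a 1 retract_of - {a}"
    by (subst (asm) affine_hull_nonempty_interior) (simp_all add: Compl_eq_Diff_UNIV)
  with \<open>contractible (- {a})\<close> have "contractible (sphere a 1)"
    by (rule retract_of_contractible)
  then show False
    by (simp add: contractible_sphere)
qed

theorem mainTheorem4:
  fixes F :: "real ^ 'n \<Rightarrow> real ^ 'm"
    and x0 :: "real ^ 'n"
    and r :: real
  assumes "r > 0"
    and "continuous_on (cball x0 r) F"
    and "\<And>x. x \<in> sphere x0 r \<Longrightarrow> F x \<noteq> 0"
    and "secat (top_of_set (sphere x0 r)) (top_of_set (UNIV - {0})) F = 1"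
  shows "\<exists>x\<in>cball x0 r. F x = 0"
proof (rule ccontr)
  assume "\<not> ?thesis"
  then have F: "F \<in> cball x0 r \<rightarrow> - {0}"
    by auto
  obtain s where "continuous_map (top_of_set (UNIV - {0})) (top_of_set (sphere x0 r)) s"
    and "homotopic_with_canon (\<lambda>_. True) (UNIV - {0}) (UNIV - {0}) (F \<circ> s) id"
    using secat_eq_1_imp_homotopy_section[OF assms(4)] .
  then have s: "continuous_on (- {0}) s" "s \<in> - {0} \<rightarrow> sphere x0 r"
    and Fs: "homotopic_with_canon (\<lambda>_. True) (- {0}) (- {0}) (F \<circ> s) id"
    unfolding Compl_eq_Diff_UNIV[symmetric] by simp_all
  \<comment> \<open>Enlarging the codomain from the sphere to the convex ball makes
    \<open>F \<circ> s\<close> nullhomotopic; \<open>F\<close> maps the whole ball into the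
    punctured space by the assumed absence of zeros.\<close>
  have "s \<in> - {0} \<rightarrow> cball x0 r"
    using s(2) by (auto simp: Pi_iff)
  then obtain c where "homotopic_with_canon (\<lambda>_. True) (- {0}) (- {0}) (F \<circ> s) (\<lambda>_. c)"
    by (rule nullhomotopic_through_contractible
        [OF s(1) _ assms(2) F convex_imp_contractible[OF convex_cball]])
  with Fs have "homotopic_with_canon (\<lambda>_. True) (- {0}) (- {0 :: real ^ 'm}) id (\<lambda>_. c)"
    by (rule homotopic_with_trans[OF homotopic_with_symD])
  then have "contractible (- {0 :: real ^ 'm})"
    unfolding contractible_def by blast
  then show False
    using not_contractible_punctured_space by blast
qed

end
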